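(* Let $d\ge1$ and $0<\alpha<1$. Let $u_{0,1},u_{0,2}\in L^\infty(\mathbb R^d)$ be nonnegative, radially non-increasing and such that $u_{0,1}\ge u_{0,2}$ in $\mathbb R^d$. Let $u_1,u_2$ be the corresponding solutions by characteristics with rarefaction fans (defined in the context) with initial data $u_{0,1},u_{0,2}$. Then $u_1\ge u_2$ in $[0,+\infty)\times\mathbb R^d$.
   Context: $\omega_d$ is the volume of the unit ball of $\mathbb R^d$; radial functions on $\mathbb R^d$ are identified with functions of the volume variable $\rho=\omega_d|x|^d\ge0$. For a nonnegative, bounded, non-increasing $u_0:[0,\infty)\to[0,\infty)$, $u_0\not\equiv0$, let $m_0(\rho)=\int_0^\rho u_0(s)\,ds$, let $u_0(\rho^\pm)$ be the one-sided limits (with $u_0(0^-):=u_0(0^+)$), and let $D=\{(\rho_0,\eta_0):\rho_0\ge0,\ \eta_0>0,\ \eta_0\in[u_0(\rho_0^+),u_0(\rho_0^-)]\}$. For $t>0$ the map $P_t:D\to[0,+\infty)$, $P_t(\rho_0,\eta_0)=\rho_0+\alpha m_0(\rho_0)\eta_0^{\alpha-1}t$, is a bijection. The solution by characteristics with rarefaction fans with datum $u_0$ is $u(t,\rho)=(\eta_0^{-\alpha}+\alpha t)^{-1/\alpha}$ with $(\rho_0,\eta_0)=P_t^{-1}(\rho)$ for $t>0$, and $u(0,\cdot)=u_0$. If $u_0\equiv0$, then $u\equiv0$. *)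

theory Defs
  imports "HOL-Analysis.Analysis"
begin

text \<open>
  The space \<open>\<real>\<^sup>d\<close> is a type \<open>'a :: euclidean_space\<close> with \<open>d = DIM('a)\<close>; such types always
  have positive dimension.
\<close>

definition volume_var :: "'a::euclidean_space \<Rightarrow> real" where
  "volume_var x = measure lborel (ball (0::'a) 1) * norm x ^ DIM('a)"

text \<open>This implies that \<open>u\<close> is radial.\<close>

definition radially_nonincreasing :: "('a::euclidean_space \<Rightarrow> real) \<Rightarrow> bool" where
  "radially_nonincreasing u \<longleftrightarrow> (\<forall>x y. norm x \<le> norm y \<longrightarrow> u y \<le> u x)"

definition L_infinity :: "('a::euclidean_space \<Rightarrow> real) set" where
  "L_infinity = {u \<in> borel_measurable lebesgue. \<exists>C. AE x in lebesgue. \<bar>u x\<bar> \<le> C}"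

text \<open>
  The function of the volume variable identified with a radial function. The choice of the point
  on the sphere is immaterial for radial \<open>u\<close>, see \<open>radial_profile_volume_var\<close> below.
  Only values at \<open>\<rho> \<ge> 0\<close> are meaningful.
\<close>

definition radial_profile :: "('a::euclidean_space \<Rightarrow> real) \<Rightarrow> real \<Rightarrow> real" where
  "radial_profile u \<rho> = u (SOME x. volume_var x = \<rho>)"

lemma volume_var_eq_iff: "volume_var x = volume_var y \<longleftrightarrow> norm x = norm y"
  for x y :: "'a::euclidean_space"
proof -
  have "measure lborel (ball (0::'a) 1) > 0"
    by (rule content_ball_pos) simp
  then show ?thesis
    by (auto simp: volume_var_def power_eq_iff_eq_base)
qed

lemma radial_profile_volume_var:
  fixes x :: "'a::euclidean_space"
  assumes "radially_nonincreasing u"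
  shows "radial_profile u (volume_var x) = u x"
proof -
  define y where "y = (SOME y::'a. volume_var y = volume_var x)"
  have "volume_var y = volume_var x"
    unfolding y_def by (rule someI[of _ x]) (rule refl)
  then have "norm y = norm x"
    by (simp add: volume_var_eq_iff)
  then have "u y = u x"
    using assms by (auto simp: radially_nonincreasing_def intro: antisym)
  then show ?thesis
    by (simp add: radial_profile_def y_def)
qed

text \<open>
  In the following, \<open>u\<^sub>0\<close> is a function of the volume variable \<open>\<rho> \<ge> 0\<close>, extended arbitrarily
  to \<open>\<rho> < 0\<close>.
\<close>

definition mass :: "(real \<Rightarrow> real) \<Rightarrow> real \<Rightarrow> real" where
  "mass u\<^sub>0 \<rho> = integral {0..\<rho>} u\<^sub>0"

definition right_value :: "(real \<Rightarrow> real) \<Rightarrow> real \<Rightarrow> real" where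
  "right_value u\<^sub>0 \<rho> = Lim (at_right \<rho>) u\<^sub>0"

definition left_value :: "(real \<Rightarrow> real) \<Rightarrow> real \<Rightarrow> real" where
  "left_value u\<^sub>0 \<rho> = (if \<rho> = 0 then right_value u\<^sub>0 0 else Lim (at_left \<rho>) u\<^sub>0)"

definition fan_domain :: "(real \<Rightarrow> real) \<Rightarrow> (real \<times> real) set" where
  "fan_domain u\<^sub>0 =
     {(\<rho>\<^sub>0, \<eta>\<^sub>0). 0 \<le> \<rho>\<^sub>0 \<and> 0 < \<eta>\<^sub>0 \<and> \<eta>\<^sub>0 \<in> {right_value u\<^sub>0 \<rho>\<^sub>0 .. left_value u\<^sub>0 \<rho>\<^sub>0}}"

definition fan_map :: "real \<Rightarrow> (real \<Rightarrow> real) \<Rightarrow> real \<Rightarrow> real \<times> real \<Rightarrow> real" where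
  "fan_map \<alpha> u\<^sub>0 t = (\<lambda>(\<rho>\<^sub>0, \<eta>\<^sub>0). \<rho>\<^sub>0 + \<alpha> * mass u\<^sub>0 \<rho>\<^sub>0 * \<eta>\<^sub>0 powr (\<alpha> - 1) * t)"

text \<open>
  The solution by characteristics with rarefaction fans, in the volume variable. The datum is an
  element of \<open>L\<^sup>\<infinity>\<close>, so \<open>u\<^sub>0 \<equiv> 0\<close> is meant almost everywhere: a pointwise reading would
  leave a datum such as the indicator of \<open>{0}\<close>, for which \<open>fan_domain\<close> is empty, without a
  solution. At \<open>t = 0\<close> the given representative of the datum is returned unchanged.
\<close>

definition fan_solution_vol :: "real \<Rightarrow> (real \<Rightarrow> real) \<Rightarrow> real \<Rightarrow> real \<Rightarrow> real" where
  "fan_solution_vol \<alpha> u\<^sub>0 t \<rho> =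
     (if t = 0 then u\<^sub>0 \<rho>
      else if AE s in lebesgue. 0 \<le> s \<longrightarrow> u\<^sub>0 s = 0 then 0
      else let (\<rho>\<^sub>0, \<eta>\<^sub>0) = inv_into (fan_domain u\<^sub>0) (fan_map \<alpha> u\<^sub>0 t) \<rho>
           in (\<eta>\<^sub>0 powr (- \<alpha>) + \<alpha> * t) powr (- 1 / \<alpha>))"

definition fan_solution ::
    "real \<Rightarrow> ('a::euclidean_space \<Rightarrow> real) \<Rightarrow> real \<Rightarrow> 'a \<Rightarrow> real" where
  "fan_solution \<alpha> u\<^sub>0 t x = fan_solution_vol \<alpha> (radial_profile u\<^sub>0) t (volume_var x)"

end

theory Submission
  imports Defs
begin

text \<open>
  Write \<open>(\<rho>\<^sub>i, \<eta>\<^sub>i)\<close> for the preimages of the same \<open>\<rho>\<close> under the two characteristic maps and suppose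
  \<open>\<eta>\<^sub>1 < \<eta>\<^sub>2\<close>. Monotonicity and the ordering of the data force \<open>\<rho>\<^sub>2 \<le> \<rho>\<^sub>1\<close>, so that every term of
  \<open>\<rho>\<^sub>1 + \<alpha> m\<^sub>1(\<rho>\<^sub>1) \<eta>\<^sub>1\<^bsup>\<alpha>-1\<^esup> t\<close> dominates the corresponding term of
  \<open>\<rho>\<^sub>2 + \<alpha> m\<^sub>2(\<rho>\<^sub>2) \<eta>\<^sub>2\<^bsup>\<alpha>-1\<^esup> t\<close>, strictly if \<open>\<rho>\<^sub>1 > 0\<close>; and \<open>\<rho>\<^sub>1 = 0\<close> leaves \<open>\<eta>\<^sub>i = u\<^bsub>0,i\<^esub>(0\<^sup>+)\<close>.
  The preimages exist because the largest admissible foot point \<open>a\<close> of characteristics arriving at or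
  to the left of \<open>\<rho>\<close> has \<open>\<rho>\<close> between the arrival points of the two extreme rays of its fan.
\<close>

section \<open>The volume variable and radial profiles\<close>

lemma volume_var_surj:
  assumes "0 \<le> \<rho>"
  obtains x :: "'a::euclidean_space" where "volume_var x = \<rho>"
proof -
  let ?w = "measure lborel (ball (0::'a) 1)"
  have w: "?w > 0"
    by (rule content_ball_pos) simp
  obtain b :: 'a where b: "b \<in> Basis"
    using nonempty_Basis by blast
  have "volume_var (root DIM('a) (\<rho> / ?w) *\<^sub>R b) = \<rho>"
    using w assms b by (simp add: volume_var_def real_root_pow_pos2)
  then show ?thesis
    by (rule that)
qed

lemma volume_var_le_iff: "volume_var x \<le> volume_var y \<longleftrightarrow> norm x \<le> norm y"
  for x y :: "'a::euclidean_space"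
proof -
  have "measure lborel (ball (0::'a) 1) > 0"
    by (rule content_ball_pos) simp
  then show ?thesis
    by (simp add: volume_var_def power_mono_iff)
qed

lemma volume_var_nonneg: "0 \<le> volume_var x"
  by (simp add: volume_var_def)

text \<open>Every nonnegative number is the volume variable of some point, so there the choice in
  \<open>radial_profile\<close> picks the right sphere. At negative arguments it is arbitrary, hence
  the restriction to \<open>{0..}\<close>.\<close>

lemma antimono_on_radial_profile:
  fixes u :: "'a::euclidean_space \<Rightarrow> real"
  assumes "radially_nonincreasing u"
  shows "antimono_on {0..} (radial_profile u)"
proof (rule monotone_onI)
  fix r s :: real
  assume rs: "r \<in> {0..}" "s \<in> {0..}" "r \<le> s"
  obtain x :: 'a where x: "volume_var x = r"
    using rs(1) by (auto intro: volume_var_surj)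
  obtain y :: 'a where y: "volume_var y = s"
    using rs(2) by (auto intro: volume_var_surj)
  have "norm x \<le> norm y"
    using rs x y volume_var_le_iff by blast
  then have "u y \<le> u x"
    using assms by (auto simp: radially_nonincreasing_def)
  then show "radial_profile u s \<le> radial_profile u r"
    using radial_profile_volume_var[OF assms] x y by metis
qed

section \<open>One-sided limits of a monotone datum\<close>

locale monotone_datum =
  fixes f :: "real \<Rightarrow> real"
  assumes anti: "antimono_on {0..} f"
    and nonneg: "\<And>s. 0 \<le> f s"
begin

lemma antiD: "0 \<le> r \<Longrightarrow> r \<le> s \<Longrightarrow> f s \<le> f r"
  using anti by (auto simp: monotone_on_def)

text \<open>As the argument decreases to \<open>a\<close>, the values increase to their supremum,
  finite since \<open>f a\<close> bounds them. This makes the \<open>Lim\<close> in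
  \<open>right_value\<close> a genuine limit.\<close>

lemma tendsto_right_value:
  assumes "0 \<le> a"
  shows "(f \<longlongrightarrow> right_value f a) (at_right a)"
proof -
  have bdd: "bdd_above (f ` {a<..})"
    using assms by (auto intro!: bdd_aboveI[of _ "f a"] antiD)
  have "(f \<longlongrightarrow> (SUP s\<in>{a<..}. f s)) (at_right a)"
  proof (rule increasing_tendsto)
    show "\<forall>\<^sub>F s in at_right a. f s \<le> (SUP s\<in>{a<..}. f s)"
      by (auto simp: eventually_at_right_field intro!: cSUP_upper bdd exI[of _ "a + 1"])
    fix x assume "x < (SUP s\<in>{a<..}. f s)"
    then obtain s where s: "a < s" "x < f s"
      using bdd by (auto simp: less_cSUP_iff)
    have "x < f r" if "a < r" "r < s" for r
      using s that assms antiD[of r s] by auto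
    then show "\<forall>\<^sub>F r in at_right a. x < f r"
      using s by (auto simp: eventually_at_right_field)
  qed
  then show ?thesis
    unfolding right_value_def by (simp add: tendsto_Lim)
qed

lemma tendsto_left_value:
  assumes "0 < a"
  shows "(f \<longlongrightarrow> left_value f a) (at_left a)"
proof -
  have bdd: "bdd_below (f ` {0..<a})"
    by (rule bdd_belowI[of _ 0]) (auto intro: nonneg)
  have ne: "{0..<a} \<noteq> {}"
    using assms by auto
  have "(f \<longlongrightarrow> (INF s\<in>{0..<a}. f s)) (at_left a)"
  proof (rule decreasing_tendsto)
    show "\<forall>\<^sub>F s in at_left a. (INF s\<in>{0..<a}. f s) \<le> f s"
      using assms
      by (auto simp: eventually_at_left_field intro!: cINF_lower bdd exI[of _ 0])
    fix x assume "(INF s\<in>{0..<a}. f s) < x"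
    then obtain s where s: "0 \<le> s" "s < a" "f s < x"
      using bdd ne by (auto simp: cINF_less_iff)
    have "f r < x" if "s < r" "r < a" for r
      using s that antiD[of s r] by auto
    then show "\<forall>\<^sub>F r in at_left a. f r < x"
      using s by (auto simp: eventually_at_left_field)
  qed
  then show ?thesis
    using assms unfolding left_value_def by (simp add: tendsto_Lim)
qed

lemma right_value_nonneg: "0 \<le> a \<Longrightarrow> 0 \<le> right_value f a"
  by (rule tendsto_lowerbound[OF tendsto_right_value]) (simp_all add: nonneg)

lemma le_right_value:
  assumes "0 \<le> a" "a < s"
  shows "f s \<le> right_value f a"
proof (rule tendsto_lowerbound[OF tendsto_right_value])
  show "\<forall>\<^sub>F r in at_right a. f s \<le> f r"
    using assms by (auto simp: eventually_at_right_field intro!: antiD exI[of _ s])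
qed (use assms in auto)

lemma left_value_le:
  assumes "0 \<le> s" "s < a"
  shows "left_value f a \<le> f s"
proof (rule tendsto_upperbound[OF tendsto_left_value])
  show "\<forall>\<^sub>F r in at_left a. f r \<le> f s"
    using assms by (auto simp: eventually_at_left_field intro!: antiD exI[of _ s])
qed (use assms in auto)

text \<open>A point in between separates the two limits. Hence the intervals of admissible values at
  two feet are ordered and share at most an endpoint.\<close>

lemma left_value_le_right_value:
  assumes "0 \<le> r" "r < s"
  shows "left_value f s \<le> right_value f r"
proof -
  obtain q where "r < q" "q < s"
    using assms dense by blast
  then show ?thesis
    using assms le_right_value[of r q] left_value_le[of q s] by auto
qed

section \<open>The mass function and vanishing data\<close>

lemma integrable: "f integrable_on {r..s}" if "0 \<le> r"
proof -
  have "mono_on {r..s} (\<lambda>x. - f x)"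
    using that by (auto intro!: monotone_onI antiD)
  then have "(\<lambda>x. - f x) integrable_on {r..s}"
    by (rule integrable_on_mono_on)
  then show ?thesis
    by (simp add: integrable_neg_iff)
qed

lemma mass_0: "mass f 0 = 0"
  by (simp add: mass_def)

lemma mass_nonneg: "0 \<le> mass f s"
  \<comment> \<open>For negative \<open>s\<close> the interval is empty and the integral is
    0.\<close>
  by (cases "0 \<le> s") (auto simp: mass_def intro!: Henstock_Kurzweil_Integration.integral_nonneg integrable nonneg)

lemma mass_mono: "r \<le> s \<Longrightarrow> mass f r \<le> mass f s"
  unfolding mass_def by (intro integral_subset_le integrable) (auto intro: nonneg)

text \<open>The window \<open>{0..a + 1}\<close> reaches to both sides of a positive
  \<open>a\<close>, so both one-sided limits follow by restriction.\<close>

lemma tendsto_mass: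
  assumes "0 \<le> a"
  shows "(mass f \<longlongrightarrow> mass f a) (at a within {0..a + 1})"
proof -
  have "continuous_on {0..a + 1} (mass f)"
    unfolding mass_def using integrable[of 0 "a + 1"]
    by (intro indefinite_integral_continuous_1) auto
  then show ?thesis
    using assms by (auto simp: continuous_on_def)
qed

lemma tendsto_mass_right:
  assumes "0 \<le> a"
  shows "(mass f \<longlongrightarrow> mass f a) (at_right a)"
proof -
  have "at_right a = at a within {a..a + 1}"
    by (simp add: at_within_Icc_at_right)
  also have "\<dots> \<le> at a within {0..a + 1}"
    using assms by (intro at_le) auto
  finally show ?thesis
    using tendsto_mass[OF assms] by (rule tendsto_mono)
qed

lemma tendsto_mass_left:
  assumes "0 < a"
  shows "(mass f \<longlongrightarrow> mass f a) (at_left a)"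
proof -
  have "at_left a = at a within {0..a}"
    using assms by (simp add: at_within_Icc_at_left)
  also have "\<dots> \<le> at a within {0..a + 1}"
    by (intro at_le) auto
  finally show ?thesis
    using tendsto_mass assms by (auto intro: tendsto_mono)
qed

text \<open>By monotonicity the right limit at 0 is the essential supremum over the half-line. This
  reduces the zero branch of \<open>fan_solution_vol\<close> to a condition on one number.\<close>

lemma AE_eq_0_iff: "(AE s in lebesgue. 0 \<le> s \<longrightarrow> f s = 0) \<longleftrightarrow> right_value f 0 = 0"
proof
  assume ae: "AE s in lebesgue. 0 \<le> s \<longrightarrow> f s = 0"
  show "right_value f 0 = 0"
  proof (rule ccontr)
    assume "right_value f 0 \<noteq> 0"
    then have "0 < right_value f 0"
      using right_value_nonneg[of 0] by auto
    then have "\<forall>\<^sub>F s in at_right 0. 0 < f s"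
      using tendsto_right_value[of 0] by (auto dest: order_tendstoD(1))
    then obtain b where b: "0 < b" "\<And>s. 0 < s \<Longrightarrow> s < b \<Longrightarrow> 0 < f s"
      by (auto simp: eventually_at_right_field)
    have "AE s in lebesgue. s \<notin> {0<..<b}"
      using ae by eventually_elim (use b in force)
    then have "{0<..<b} \<in> null_sets lebesgue"
      by (subst (asm) AE_iff_null_sets[symmetric]) auto
    then show False
      using b by (auto simp: null_sets_def)
  qed
next
  assume "right_value f 0 = 0"
  then have 0: "f s = 0" if "0 < s" for s
    using that le_right_value[of 0 s] nonneg[of s] by auto
  have "AE s in lebesgue. s \<noteq> (0::real)"
    by (rule AE_I'[of "{0}"]) auto
  then show "AE s in lebesgue. 0 \<le> s \<longrightarrow> f s = 0"
    by eventually_elim (use 0 in auto)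
qed

lemma mass_pos:
  assumes "0 < right_value f 0" "0 < a"
  shows "0 < mass f a"
proof -
  have "\<forall>\<^sub>F s in at_right 0. 0 < f s"
    using assms tendsto_right_value[of 0] by (auto dest: order_tendstoD(1))
  then obtain b where b: "0 < b" "\<And>s. 0 < s \<Longrightarrow> s < b \<Longrightarrow> 0 < f s"
    by (auto simp: eventually_at_right_field)
  \<comment> \<open>The rectangle of width \<open>c\<close> and height \<open>f c\<close> fits under
    the graph; halving \<open>b\<close> keeps \<open>c\<close> strictly inside the interval of
    positivity.\<close>
  define c where "c = min a (b / 2)"
  have c: "0 < c" "c \<le> a" "0 < f c"
    using assms b by (auto simp: c_def min_def)
  have "0 < c * f c"
    using c by simp
  also have "\<dots> = integral {0..c} (\<lambda>_. f c)"
    using c by simp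
  also have "\<dots> \<le> mass f c"
    unfolding mass_def by (intro integral_le integrable) (auto intro: antiD)
  also have "\<dots> \<le> mass f a"
    using c by (intro mass_mono)
  finally show ?thesis .
qed

section \<open>Surjectivity of the characteristic map\<close>

lemma fan_map_surj:
  assumes \<alpha>: "0 < \<alpha>" "\<alpha> < 1" and t: "0 < t" and f0: "0 < right_value f 0" and \<rho>: "0 \<le> \<rho>"
  shows "\<rho> \<in> fan_map \<alpha> f t ` fan_domain f"
proof -
  \<comment> \<open>Feet whose ray, launched with the pointwise value \<open>f s\<close>, has not
    passed \<rho> at time \<open>t\<close>. The one-sided values enter only in the limit at
    \<open>Sup A\<close>.\<close>
  define A where "A = {s. 0 \<le> s \<and> 0 < f s \<and> s + \<alpha> * mass f s * f s powr (\<alpha> - 1) * t \<le> \<rho>}"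
  define a where "a = Sup A"
  have A_le: "s \<le> \<rho>" if "s \<in> A" for s
  proof -
    have "0 \<le> \<alpha> * mass f s * f s powr (\<alpha> - 1) * t"
      using \<alpha> t mass_nonneg by simp
    with that show ?thesis
      by (auto simp: A_def)
  qed
  have bdd: "bdd_above A"
    using A_le by (auto intro!: bdd_aboveI)
  have "right_value f 0 \<le> f 0"
    by (rule tendsto_upperbound[OF tendsto_right_value])
       (auto simp: eventually_at_right_field intro!: antiD exI[of _ 1])
  then have "0 \<in> A"
    using f0 \<rho> by (auto simp: A_def mass_0)
  then have a0: "0 \<le> a"
    unfolding a_def by (rule cSup_upper[OF _ bdd])
  \<comment> \<open>Moving the foot left lowers the mass and raises the value, and \<alpha> - 1 is
    negative: the arrival point moves left too.\<close>
  have down: "s \<in> A" if s: "0 \<le> s" "s < a" for s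
  proof -
    obtain r where r: "r \<in> A" "s < r"
      using s \<open>0 \<in> A\<close> less_cSupD[of A s] unfolding a_def by blast
    then have fr: "f r \<le> f s" "0 < f r"
      using that by (auto simp: A_def intro: antiD)
    have "mass f s * f s powr (\<alpha> - 1) \<le> mass f r * f r powr (\<alpha> - 1)"
      using r fr \<alpha> by (intro mult_mono powr_mono2' mass_mono mass_nonneg) auto
    then have "\<alpha> * mass f s * f s powr (\<alpha> - 1) * t \<le> \<alpha> * mass f r * f r powr (\<alpha> - 1) * t"
      using \<alpha> t by (simp add: mult.assoc mult_left_mono)
    then show ?thesis
      using r fr that by (auto simp: A_def)
  qed
  have up: "\<rho> < s + \<alpha> * mass f s * f s powr (\<alpha> - 1) * t" if "a < s" "0 < f s" for s
  proof -
    have "s \<notin> A"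
      using that cSup_upper[OF _ bdd, of s] unfolding a_def by force
    then show ?thesis
      using that a0 by (auto simp: A_def)
  qed
  \<comment> \<open>The slowest value in the fan arrives at or beyond \<rho>. The value 0 is
    excluded: \<open>0 powr (\<alpha> - 1)\<close> is 0 by convention, whereas arrival points blow
    up as the value tends to 0.\<close>
  have right: "\<rho> \<le> a + \<alpha> * mass f a * right_value f a powr (\<alpha> - 1) * t"
    if "0 < right_value f a"
  proof (rule tendsto_lowerbound)
    show "((\<lambda>s. s + \<alpha> * mass f s * f s powr (\<alpha> - 1) * t) \<longlongrightarrow>
        a + \<alpha> * mass f a * right_value f a powr (\<alpha> - 1) * t) (at_right a)"
      using that a0
      by (intro tendsto_intros tendsto_right_value tendsto_mass_right) auto
    have "\<forall>\<^sub>F s in at_right a. 0 < f s"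
      using that a0 tendsto_right_value by (auto dest: order_tendstoD(1))
    moreover have "\<forall>\<^sub>F s in at_right a. a < s"
      by (simp add: eventually_at_right_less)
    ultimately show "\<forall>\<^sub>F s in at_right a. \<rho> \<le> s + \<alpha> * mass f s * f s powr (\<alpha> - 1) * t"
      by eventually_elim (use up in force)
  qed simp
  show ?thesis
  proof (cases "a = 0")
    case True
    \<comment> \<open>No mass lies to the left of the foot 0, so its ray does not move.\<close>
    have "\<rho> \<le> 0"
      using right f0 True by (simp add: mass_0)
    then have "\<rho> = fan_map \<alpha> f t (0, right_value f 0)"
      using \<rho> by (simp add: fan_map_def mass_0)
    moreover have "(0, right_value f 0) \<in> fan_domain f"
      using f0 by (simp add: fan_domain_def left_value_def)
    ultimately show ?thesis
      by blast
  next
    case False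
    then have a: "0 < a"
      using a0 by simp
    define c where "c = \<alpha> * mass f a * t"
    have c: "0 < c"
      using \<alpha> t mass_pos[OF f0 a] by (simp add: c_def)
    have near: "\<forall>\<^sub>F s in at_left a. s \<in> A \<and> a / 2 < s"
      using a down by (auto simp: eventually_at_left_field intro!: exI[of _ "a / 2"])
    \<comment> \<open>Values tending to 0 would send the rays to infinity, but feet in
      \<open>A\<close> arrive no further than \<rho>. Staying right of \<open>a / 2\<close> bounds
      the mass below, and solving for the value gives the lower bound \<open>z\<close>.\<close>
    have L: "0 < left_value f a"
    proof -
      define k where "k = \<alpha> * mass f (a / 2) * t"
      have k: "0 < k"
        using \<alpha> t mass_pos[OF f0, of "a / 2"] a by (simp add: k_def)
      define z where "z = ((\<rho> + 1) / k) powr (1 / (\<alpha> - 1))"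
      have "\<forall>\<^sub>F s in at_left a. z \<le> f s"
        using near
      proof eventually_elim
        case (elim s)
        then have s: "0 < f s" "s + \<alpha> * mass f s * f s powr (\<alpha> - 1) * t \<le> \<rho>" "0 \<le> s"
          by (auto simp: A_def)
        have "k * f s powr (\<alpha> - 1) \<le> \<alpha> * mass f s * t * f s powr (\<alpha> - 1)"
          unfolding k_def using elim \<alpha> t
          by (intro mult_right_mono mult_left_mono mass_mono) auto
        also have "\<dots> \<le> \<rho> + 1"
          using s by (simp add: mult_ac)
        finally have "f s powr (\<alpha> - 1) \<le> (\<rho> + 1) / k"
          using k by (simp add: field_simps)
        then have "z \<le> (f s powr (\<alpha> - 1)) powr (1 / (\<alpha> - 1))"
          unfolding z_def using \<alpha> s by (intro powr_mono2') auto
        also have "\<dots> = f s"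
          using \<alpha> s by (simp add: powr_powr)
        finally show ?case .
      qed
      then have "z \<le> left_value f a"
        by (intro tendsto_lowerbound[OF tendsto_left_value[OF a]]) auto
      moreover have "0 < z"
        using k \<rho> by (auto simp: z_def)
      ultimately show ?thesis
        by simp
    qed
    have left: "a + \<alpha> * mass f a * left_value f a powr (\<alpha> - 1) * t \<le> \<rho>"
    proof (rule tendsto_upperbound)
      show "((\<lambda>s. s + \<alpha> * mass f s * f s powr (\<alpha> - 1) * t) \<longlongrightarrow>
          a + \<alpha> * mass f a * left_value f a powr (\<alpha> - 1) * t) (at_left a)"
        using L a
        by (intro tendsto_intros tendsto_left_value tendsto_mass_left) auto
      show "\<forall>\<^sub>F s in at_left a. s + \<alpha> * mass f s * f s powr (\<alpha> - 1) * t \<le> \<rho>"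
        using near by eventually_elim (auto simp: A_def)
    qed simp
    \<comment> \<open>The value that \<open>\<eta> powr (\<alpha> - 1)\<close> must take for
      \<open>(a, \<eta>)\<close> to arrive exactly at \<rho>. As this power decreases in \<eta>,
      \<open>left\<close> and \<open>right\<close> place \<eta> inside the fan.\<close>
    define v where "v = (\<rho> - a) / c"
    have v: "left_value f a powr (\<alpha> - 1) \<le> v"
      using left c by (simp add: v_def c_def field_simps)
    have v0: "0 < v"
      using L v by (smt (verit) powr_gt_zero)
    define \<eta> where "\<eta> = v powr (1 / (\<alpha> - 1))"
    have \<eta>: "0 < \<eta>" "\<eta> powr (\<alpha> - 1) = v"
      using v0 \<alpha> by (auto simp: \<eta>_def powr_powr)
    have "\<eta> \<le> left_value f a"
    proof (rule ccontr)
      assume "\<not> \<eta> \<le> left_value f a"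
      then have "\<eta> powr (\<alpha> - 1) < left_value f a powr (\<alpha> - 1)"
        using L \<alpha> by (intro powr_less_mono2_neg) auto
      then show False
        using v \<eta> by simp
    qed
    moreover have "right_value f a \<le> \<eta>"
    proof (rule ccontr)
      assume "\<not> right_value f a \<le> \<eta>"
      then have r: "\<eta> < right_value f a"
        by simp
      then have "right_value f a powr (\<alpha> - 1) < v"
        using \<eta> \<alpha> powr_less_mono2_neg[of "\<alpha> - 1" \<eta> "right_value f a"] by auto
      \<comment> \<open>The assumption for contradiction supplies the positivity that
        \<open>right\<close> asks for.\<close>
      moreover have "v \<le> right_value f a powr (\<alpha> - 1)"
        using right r \<eta> a c by (simp add: v_def c_def field_simps)
      ultimately show False
        by simp
    qed
    ultimately have "(a, \<eta>) \<in> fan_domain f"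
      using \<eta> a by (simp add: fan_domain_def)
    moreover have "fan_map \<alpha> f t (a, \<eta>) = a + c * v"
      using \<eta> by (simp add: fan_map_def c_def mult_ac)
    then have "\<rho> = fan_map \<alpha> f t (a, \<eta>)"
      using c by (simp add: v_def)
    ultimately show ?thesis
      by blast
  qed
qed

end

section \<open>Comparison of the two solutions\<close>

lemma right_value_0_mono:
  assumes "monotone_datum f" "monotone_datum g"
    and "\<And>s. 0 \<le> s \<Longrightarrow> g s \<le> f s"
  shows "right_value g 0 \<le> right_value f 0"
proof (rule tendsto_le)
  show "(f \<longlongrightarrow> right_value f 0) (at_right 0)" "(g \<longlongrightarrow> right_value g 0) (at_right 0)"
    using assms by (auto intro: monotone_datum.tendsto_right_value)
  show "\<forall>\<^sub>F s in at_right 0. g s \<le> f s"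
    using assms by (auto simp: eventually_at_right_field intro!: exI[of _ 1])
qed simp

lemma fan_values_mono:
  assumes "monotone_datum f" "monotone_datum g"
    and le: "\<And>s. 0 \<le> s \<Longrightarrow> g s \<le> f s"
    and \<alpha>: "0 < \<alpha>" "\<alpha> < 1" and t: "0 < t" and f0: "0 < right_value f 0"
    and p: "(r, \<eta>) \<in> fan_domain f" and q: "(s, \<theta>) \<in> fan_domain g"
    and eq: "fan_map \<alpha> f t (r, \<eta>) = fan_map \<alpha> g t (s, \<theta>)"
  shows "\<theta> \<le> \<eta>"
proof (rule ccontr)
  interpret f: monotone_datum f by fact
  interpret g: monotone_datum g by fact
  assume "\<not> \<theta> \<le> \<eta>"
  then have lt: "\<eta> < \<theta>"
    by simp
  have p': "0 \<le> r" "0 < \<eta>" "right_value f r \<le> \<eta>"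
    and q': "0 \<le> s" "0 < \<theta>" "\<theta> \<le> left_value g s"
    using p q by (auto simp: fan_domain_def)
  have right: "right_value g 0 \<le> right_value f 0"
    using assms(1,2) le by (rule right_value_0_mono)
  have "s \<le> r"
  proof (rule ccontr)
    assume "\<not> s \<le> r"
    then have rs: "r < s" by simp
    \<comment> \<open>The chain runs from \<theta> through the left limits of \<open>g\<close> and
      \<open>f\<close> at \<open>s\<close> to the right limit of \<open>f\<close> at
      \<open>r\<close>, which is at most \<eta>.\<close>
    then have "left_value g s \<le> left_value f s"
      using p' f.tendsto_left_value[of s] g.tendsto_left_value[of s]
      by (intro tendsto_le[of "at_left s" f _ g])
         (auto simp: eventually_at_left_field intro!: le exI[of _ r])
    also have "\<dots> \<le> right_value f r"
      using p' rs by (intro f.left_value_le_right_value)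
    finally show False
      using p' q' lt by simp
  qed
  show False
  proof (cases "r = 0")
    case True
    \<comment> \<open>Both feet are 0, where the left value is by convention the right one.\<close>
    then have "\<theta> \<le> right_value g 0"
      using q' \<open>s \<le> r\<close> by (simp add: left_value_def)
    then show False
      using right p' lt True by simp
  next
    case False
    have "mass g s \<le> mass f s"
      unfolding mass_def by (intro integral_le f.integrable g.integrable) (auto intro: le)
    also have "\<dots> \<le> mass f r"
      using \<open>s \<le> r\<close> by (rule f.mass_mono)
    finally have "mass g s * \<theta> powr (\<alpha> - 1) \<le> mass f r * \<theta> powr (\<alpha> - 1)"
      by (simp add: mult_right_mono)
    \<comment> \<open>Strictness comes from here: the mass to the left of a positive foot is
      positive.\<close>
    also have "\<dots> < mass f r * \<eta> powr (\<alpha> - 1)"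
      using False p' lt \<alpha> f.mass_pos[OF f0, of r] by (simp add: powr_less_mono2_neg)
    finally have "\<alpha> * t * (mass g s * \<theta> powr (\<alpha> - 1)) < \<alpha> * t * (mass f r * \<eta> powr (\<alpha> - 1))"
      using \<alpha> t by simp
    then show False
      using eq \<open>s \<le> r\<close> by (simp add: fan_map_def mult_ac)
  qed
qed

lemma fan_solution_vol_mono:
  assumes "monotone_datum f" "monotone_datum g"
    and le: "\<And>s. 0 \<le> s \<Longrightarrow> g s \<le> f s"
    and \<alpha>: "0 < \<alpha>" "\<alpha> < 1" and t: "0 \<le> t" and \<rho>: "0 \<le> \<rho>"
  shows "fan_solution_vol \<alpha> g t \<rho> \<le> fan_solution_vol \<alpha> f t \<rho>"
proof -
  interpret f: monotone_datum f by fact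
  interpret g: monotone_datum g by fact
  have right: "right_value g 0 \<le> right_value f 0"
    using assms(1,2) le by (rule right_value_0_mono)
  consider "t = 0" | "0 < t" "right_value g 0 = 0" | "0 < t" "0 < right_value g 0"
    using t g.right_value_nonneg[of 0] by fastforce
  then show ?thesis
  proof cases
    case 1
    then show ?thesis
      using \<rho> le by (simp add: fan_solution_vol_def)
  next
    case 2
    then show ?thesis
      \<comment> \<open>The smaller solution is 0, and the larger is either 0 or a value of
        \<open>powr\<close>, hence nonnegative.\<close>
      by (simp add: fan_solution_vol_def f.AE_eq_0_iff g.AE_eq_0_iff split: prod.split)
  next
    case 3
    let ?p = "inv_into (fan_domain f) (fan_map \<alpha> f t) \<rho>"
    let ?q = "inv_into (fan_domain g) (fan_map \<alpha> g t) \<rho>"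
    have f0: "0 < right_value f 0"
      using 3 right by simp
    have surj: "\<rho> \<in> fan_map \<alpha> f t ` fan_domain f" "\<rho> \<in> fan_map \<alpha> g t ` fan_domain g"
      using 3 f0 \<alpha> \<rho> by (auto intro: f.fan_map_surj g.fan_map_surj)
    obtain r \<eta> s \<theta> where rs: "?p = (r, \<eta>)" "?q = (s, \<theta>)"
      by (metis surj_pair)
    have in_dom: "(r, \<eta>) \<in> fan_domain f" "(s, \<theta>) \<in> fan_domain g"
      using inv_into_into surj rs by metis+
    have "fan_map \<alpha> f t (r, \<eta>) = fan_map \<alpha> g t (s, \<theta>)"
      using f_inv_into_f surj rs by metis
    then have "\<theta> \<le> \<eta>"
      using fan_values_mono[OF assms(1,2) le \<alpha> 3(1) f0] in_dom by blast
    moreover have "0 < \<theta>" "0 < \<eta>"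
      using in_dom by (auto simp: fan_domain_def)
    \<comment> \<open>The two negative exponents compose to an increasing function of the
      transported value.\<close>
    ultimately have "(\<theta> powr (- \<alpha>) + \<alpha> * t) powr (- 1 / \<alpha>)
        \<le> (\<eta> powr (- \<alpha>) + \<alpha> * t) powr (- 1 / \<alpha>)"
      using \<alpha> 3 by (intro powr_mono2' add_right_mono add_pos_pos) auto
    then show ?thesis
      using 3 f0 rs by (simp add: fan_solution_vol_def f.AE_eq_0_iff g.AE_eq_0_iff)
  qed
qed

theorem theorem4p5:
  fixes \<alpha> :: real
    and u01 u02 :: "'a::euclidean_space \<Rightarrow> real"
    and u1 u2 :: "real \<Rightarrow> 'a \<Rightarrow> real"
  assumes "0 < \<alpha>" and "\<alpha> < 1"
    and "u01 \<in> L_infinity" and "\<And>x. 0 \<le> u01 x" and "radially_nonincreasing u01"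
    and "u02 \<in> L_infinity" and "\<And>x. 0 \<le> u02 x" and "radially_nonincreasing u02"
    and "\<And>x. u02 x \<le> u01 x"
    and "u1 = fan_solution \<alpha> u01" and "u2 = fan_solution \<alpha> u02"
  shows "\<forall>t\<ge>0. \<forall>x. u2 t x \<le> u1 t x"
proof (intro allI impI)
  fix t :: real and x :: 'a
  assume "0 \<le> t"
  have "monotone_datum (radial_profile u01)" "monotone_datum (radial_profile u02)"
    using assms by (auto simp: monotone_datum_def radial_profile_def
        intro: antimono_on_radial_profile)
  \<comment> \<open>Both profiles are evaluated at the same chosen point.\<close>
  moreover have "radial_profile u02 s \<le> radial_profile u01 s" for s
    using assms by (simp add: radial_profile_def)
  ultimately show "u2 t x \<le> u1 t x"
    using assms \<open>0 \<le> t\<close> volume_var_nonneg[of x]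
    by (simp add: fan_solution_def fan_solution_vol_mono)
qed

end
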